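(* Let $h\geq 1$ and let $\vec c=[c_1,\ldots,c_h]$ be a color sequence of dimension $h$, i.e. integers $1\leq c_1\leq c_2\leq\cdots\leq c_h$. Then the perfect binary tree $T(h)$ admits an ancestral $\vec c$-coloring if and only if $\vec c$ is $h$-feasible, i.e. if and only if (C1) $\sum_{i=1}^{\ell} c_i\geq \sum_{i=1}^{\ell}2^i$ for every $1\leq \ell\leq h$, and (C2) $\sum_{i=1}^{h} c_i = \sum_{i=1}^{h}2^i = 2^{h+1}-2$.
   Context: $T(h)$ denotes the perfect binary tree of height $h$: its nodes are $1,2,\ldots,2^{h+1}-1$, node $1$ is the root, and the children of node $R$ (for $R<2^h$) are $2R$ and $2R+1$; it has $2^h$ leaves and Layer $i$ (nodes at depth $i$) has $2^i$ nodes. An ancestral $\vec c$-coloring of $T(h)$ is an assignment of a color from $\{1,\ldots,h\}$ to every node except the root (the root is colorless) such that exactly $c_i$ nodes receive color $i$ for each $i$, and no two nodes $u,v$ such that $u$ is an ancestor of $v$ receive the same color. *)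

theory Defs
  imports Main
begin

definition tree_nodes :: "nat \<Rightarrow> nat set" where
  "tree_nodes h = {1..2 ^ (h + 1) - 1}"

(* Edges of T(h), directed from parent to child; the leaves are the nodes R with 2^h \<le> R. *)
definition tree_edges :: "nat \<Rightarrow> (nat \<times> nat) set" where
  "tree_edges h = {(R, S). 1 \<le> R \<and> R < 2 ^ h \<and> (S = 2 * R \<or> S = 2 * R + 1)}"

(* Proper ancestors: a node is not an ancestor of itself. *)
definition ancestor :: "nat \<Rightarrow> nat \<Rightarrow> nat \<Rightarrow> bool" where
  "ancestor h u v \<longleftrightarrow> (u, v) \<in> (tree_edges h)\<^sup>+"

(* Sequences [c_1, ..., c_h] are functions of which only the values at 1, ..., h matter. *)
definition color_sequence :: "nat \<Rightarrow> (nat \<Rightarrow> nat) \<Rightarrow> bool" where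
  "color_sequence h c \<longleftrightarrow> (\<forall>i\<in>{1..h}. 1 \<le> c i) \<and> mono_on {1..h} c"

(* The root 1 is colorless: the value of f at 1, or outside T(h), is irrelevant. *)
definition ancestral_coloring :: "nat \<Rightarrow> (nat \<Rightarrow> nat) \<Rightarrow> (nat \<Rightarrow> nat) \<Rightarrow> bool" where
  "ancestral_coloring h c f \<longleftrightarrow>
     (\<forall>v\<in>tree_nodes h - {1}. f v \<in> {1..h}) \<and>
     (\<forall>i\<in>{1..h}. card {v \<in> tree_nodes h - {1}. f v = i} = c i) \<and>
     (\<forall>u\<in>tree_nodes h - {1}. \<forall>v\<in>tree_nodes h - {1}. ancestor h u v \<longrightarrow> f u \<noteq> f v)"

definition feasible :: "nat \<Rightarrow> (nat \<Rightarrow> nat) \<Rightarrow> bool" where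
  "feasible h c \<longleftrightarrow>
     (\<forall>l\<in>{1..h}. (\<Sum>i=1..l. c i) \<ge> (\<Sum>i=1..l. 2 ^ i)) \<and>
     (\<Sum>i=1..h. c i) = (\<Sum>i=1..h. 2 ^ i) \<and>
     (\<Sum>i=1..h. 2 ^ i) = (2 ^ (h + 1) - 2 :: nat)"

end

(* Both directions go by induction on the height, removing the colour of a child of the root from
   the palette of the subtree below it.  For this, feasibility is restated symmetrically: any s
   colours together occur at least 2^(s+1) - 2 times.

   Sufficiency: give the two children the colours x and y and split c minus these two nodes into
   feasible sequences a and b for the two subtrees.  As S |-> 2^(|S|+1) - 2 is supermodular,
   Frank's discrete sandwich theorem yields an integral splitting as soon as c(S) dominates the sum
   of the two lower bounds for every set S of colours.  This holds if x is a rarest colour and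
   y = x when c x = 2, while y is a second rarest colour otherwise. *)

theory Submission
  imports Defs
begin

section \<open>Integral modular functions between a supermodular and a submodular bound\<close>

section \<open>The discrete sandwich theorem\<close>

definition supermodular_on :: "'a set \<Rightarrow> ('a set \<Rightarrow> int) \<Rightarrow> bool" where
  "supermodular_on K g \<longleftrightarrow> (\<forall>S T. S \<subseteq> K \<longrightarrow> T \<subseteq> K \<longrightarrow> g S + g T \<le> g (S \<union> T) + g (S \<inter> T))"

lemma supermodular_onD:
  "supermodular_on K g \<Longrightarrow> S \<subseteq> K \<Longrightarrow> T \<subseteq> K \<Longrightarrow> g S + g T \<le> g (S \<union> T) + g (S \<inter> T)"
  by (simp add: supermodular_on_def)

text \<open>These are the lower bounds left on \<open>K\<close> once \<open>e\<close> has received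
  the value \<alpha>. Whichever terms attain the two maxima on the left, one instance of
  supermodularity bounds them, with equally many \<alpha> on both sides.\<close>

lemma supermodular_on_contract:
  assumes g: "supermodular_on (insert e K) g" and e: "e \<notin> K"
  shows "supermodular_on K (\<lambda>S. max (g S) (g (insert e S) - \<alpha>))"
  unfolding supermodular_on_def
proof (intro allI impI)
  fix S T assume ST: "S \<subseteq> K" "T \<subseteq> K"
  then have ne: "e \<notin> S" "e \<notin> T" using e by auto
  have "S \<subseteq> insert e K" "T \<subseteq> insert e K" "insert e S \<subseteq> insert e K" "insert e T \<subseteq> insert e K"
    using ST by auto
  note D = supermodular_onD[OF g]
  have "g S + g T \<le> g (S \<union> T) + g (S \<inter> T)"
    by (rule D) fact+
  moreover have "g (insert e S) + g T \<le> g (insert e (S \<union> T)) + g (S \<inter> T)"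
    using D[of "insert e S" T] \<open>insert e S \<subseteq> insert e K\<close> \<open>T \<subseteq> insert e K\<close> ne by simp
  moreover have "g S + g (insert e T) \<le> g (insert e (S \<union> T)) + g (S \<inter> T)"
    using D[of S "insert e T"] \<open>S \<subseteq> insert e K\<close> \<open>insert e T \<subseteq> insert e K\<close> ne by simp
  moreover have "g (insert e S) + g (insert e T) \<le> g (insert e (S \<union> T)) + g (insert e (S \<inter> T))"
    using D[of "insert e S" "insert e T"] \<open>insert e S \<subseteq> insert e K\<close> \<open>insert e T \<subseteq> insert e K\<close>
    by simp
  ultimately show "max (g S) (g (insert e S) - \<alpha>) + max (g T) (g (insert e T) - \<alpha>)
      \<le> max (g (S \<union> T)) (g (insert e (S \<union> T)) - \<alpha>) + max (g (S \<inter> T)) (g (insert e (S \<inter> T)) - \<alpha>)"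
    by linarith
qed

text \<open>Induction on \<open>K\<close>: fix the value at one element \<open>e\<close> and pass to
  the contracted bounds on the rest. The value is integral because it is a maximum of differences of
  integers.\<close>

theorem discrete_sandwich:
  assumes "finite K"
    and "supermodular_on K g" and "supermodular_on K (\<lambda>S. - p S)"
    and "g {} = 0" and "p {} = 0" and "\<And>S. S \<subseteq> K \<Longrightarrow> g S \<le> p S"
  shows "\<exists>a :: 'a \<Rightarrow> int. \<forall>S\<subseteq>K. g S \<le> sum a S \<and> sum a S \<le> p S"
  using assms
proof (induction K arbitrary: g p rule: finite_induct)
  case empty
  then show ?case by auto
next
  case (insert e K)
  \<comment> \<open>The least value at \<open>e\<close> that keeps \<open>g (insert e S) - L\<close>
    below every \<open>p S\<close>. By \<open>lo\<close> and \<open>hi\<close> the contracted bounds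
    still do not cross.\<close>
  define L where "L = Max ((\<lambda>S. g (insert e S) - p S) ` Pow K)"
  have fin: "finite ((\<lambda>S. g (insert e S) - p S) ` Pow K)"
    using insert.hyps by simp
  have lo: "g (insert e S) - L \<le> p S" if "S \<subseteq> K" for S
    using Max_ge[OF fin, of "g (insert e S) - p S"] that unfolding L_def by auto
  have hi: "g T \<le> p (insert e T) - L" if T: "T \<subseteq> K" for T
  proof -
    have "L \<in> (\<lambda>S. g (insert e S) - p S) ` Pow K"
      unfolding L_def by (rule Max_in[OF fin]) auto
    then obtain S where S: "S \<subseteq> K" and L: "L = g (insert e S) - p S"
      by auto
    have ne: "e \<notin> S" "e \<notin> T" using S T insert.hyps by auto
    \<comment> \<open>Uncrossing at a set \<open>S\<close> that attains the maximum: supermodularity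
      of \<open>g\<close>, then \<open>g\<close> below \<open>p\<close>, then submodularity of
      \<open>p\<close>.\<close>
    have "g (insert e S) + g T \<le> g (insert e (S \<union> T)) + g (S \<inter> T)"
      using supermodular_onD[OF insert.prems(1), of "insert e S" T] S T ne by auto
    also have "\<dots> \<le> p (insert e (S \<union> T)) + p (S \<inter> T)"
      using S T by (intro add_mono insert.prems(5)) auto
    also have "\<dots> \<le> p S + p (insert e T)"
      using supermodular_onD[OF insert.prems(2) subset_insertI2[OF S] insert_mono[OF T]] ne by simp
    finally show ?thesis using L by simp
  qed
  let ?g = "\<lambda>S. max (g S) (g (insert e S) - L)"
  \<comment> \<open>The minimum of \<open>p S\<close> and \<open>p (insert e S) - L\<close>, in the
    shape that contraction gives for the negated bound and the value \<open>- L\<close>.\<close>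
  let ?p = "\<lambda>S. - max (- p S) (- p (insert e S) - - L)"
  have "\<exists>a :: 'a \<Rightarrow> int. \<forall>S\<subseteq>K. ?g S \<le> sum a S \<and> sum a S \<le> ?p S"
  proof (rule insert.IH)
    show "supermodular_on K ?g"
      using insert.prems(1) insert.hyps(2) by (rule supermodular_on_contract)
    show "supermodular_on K (\<lambda>S. - ?p S)"
      using supermodular_on_contract[OF insert.prems(2) insert.hyps(2), of "- L"] by simp
    show "?g {} = 0" "?p {} = 0"
      using lo[of "{}"] hi[of "{}"] insert.prems(3,4) by auto
    show "?g S \<le> ?p S" if "S \<subseteq> K" for S
    proof -
      have "g S \<le> p S" "g (insert e S) \<le> p (insert e S)"
        using insert.prems(5)[of S] insert.prems(5)[of "insert e S"] that by auto
      then show ?thesis using lo[OF that] hi[OF that] by linarith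
    qed
  qed
  then obtain a :: "'a \<Rightarrow> int" where a: "\<And>S. S \<subseteq> K \<Longrightarrow> ?g S \<le> sum a S \<and> sum a S \<le> ?p S"
    by blast
  have "g S \<le> sum (a(e := L)) S \<and> sum (a(e := L)) S \<le> p S" if S: "S \<subseteq> insert e K" for S
  proof -
    define S' where "S' = S - {e}"
    have S': "S' \<subseteq> K" "e \<notin> S'" using S by (auto simp: S'_def)
    have "finite S'" using S' insert.hyps finite_subset by blast
    have eq: "sum (a(e := L)) S' = sum a S'"
      by (rule sum.cong) (use S' in auto)
    show ?thesis
    proof (cases "e \<in> S")
      case True
      then have "S = insert e S'" by (auto simp: S'_def)
      moreover have "sum (a(e := L)) (insert e S') = L + sum a S'"
        using S' \<open>finite S'\<close> eq by simp
      ultimately show ?thesis using a[OF S'(1)] by auto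
    next
      case False
      then have "S = S'" by (auto simp: S'_def)
      then show ?thesis using a[OF S'(1)] eq by auto
    qed
  qed
  then show ?case by blast
qed

section \<open>Splitting colour counts between the two subtrees of the root\<close>

section \<open>Splitting feasible colour counts\<close>

text \<open>Quantifying over all sets of colours instead of initial segments removes the order of
  the colours, so that any one colour can be deleted. Integer values keep later differences from
  being truncated.\<close>

definition feasible_on :: "'a set \<Rightarrow> ('a \<Rightarrow> int) \<Rightarrow> bool" where
  "feasible_on K c \<longleftrightarrow>
     (\<forall>S\<subseteq>K. 2 ^ (card S + 1) - 2 \<le> sum c S) \<and> sum c K = 2 ^ (card K + 1) - 2"

text \<open>The right side exceeds the left by twice \<open>2^i * (2^p - 1) * (2^q - 1)\<close>,
  where \<open>i\<close>, \<open>p\<close>, \<open>q\<close> are the sizes of the intersection and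
  of the two differences of \<open>S - X\<close> and \<open>T - X\<close>.\<close>

lemma supermodular_on_pow2_card:
  assumes "finite K"
  shows "supermodular_on K (\<lambda>S. 2 ^ (card (S - X) + 1) - 2)"
  unfolding supermodular_on_def
proof (intro allI impI)
  fix S T assume ST: "S \<subseteq> K" "T \<subseteq> K"
  define A B where "A = S - X" and "B = T - X"
  have fin: "finite A" "finite B"
    using ST assms by (auto simp: A_def B_def intro: finite_subset)
  define i p q where "i = card (A \<inter> B)" and "p = card (A - B)" and "q = card (B - A)"
  have A: "card A = i + p"
    unfolding i_def p_def using fin(1) by (metis card_Int_Diff)
  have B: "card B = i + q"
    unfolding i_def q_def using fin(2) by (metis card_Int_Diff Int_commute)
  have AB: "card (A \<union> B) = i + p + q"
    using card_Un_Int[OF fin] A B by (simp add: i_def)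
  have eqs: "(S \<union> T) - X = A \<union> B" "(S \<inter> T) - X = A \<inter> B"
    by (auto simp: A_def B_def)
  have "0 \<le> (2 ^ i * ((2 ^ p - 1) * (2 ^ q - 1)) :: int)"
    by simp
  then show "(2 ^ (card (S - X) + 1) - 2) + (2 ^ (card (T - X) + 1) - 2 :: int)
      \<le> (2 ^ (card ((S \<union> T) - X) + 1) - 2) + (2 ^ (card ((S \<inter> T) - X) + 1) - 2)"
    unfolding eqs A_def[symmetric] B_def[symmetric] A B AB i_def[symmetric]
    by (simp add: power_add algebra_simps)
qed

text \<open>Here \<open>x\<close> and \<open>y\<close> are the colours of the two children, while
  \<open>a\<close> and \<open>b\<close> count colours strictly below them. A lower bound on
  \<open>b\<close> is an upper bound on \<open>a\<close>, and \<open>dom\<close> says that it lies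
  above the lower bound on \<open>a\<close>, as the sandwich theorem demands.\<close>

lemma feasible_on_split_if_dominated:
  fixes c :: "'a \<Rightarrow> int"
  assumes K: "finite K" "x \<in> K" "y \<in> K" and c: "sum c K = 2 ^ (card K + 1) - 2"
    and dom: "\<And>S. S \<subseteq> K \<Longrightarrow> (2 ^ (card (S - {x}) + 1) - 2) + (2 ^ (card (S - {y}) + 1) - 2)
        \<le> sum c S - of_bool (x \<in> S) - of_bool (y \<in> S)"
  obtains a b where "feasible_on (K - {x}) a" "feasible_on (K - {y}) b" "a x = 0" "b y = 0"
    "\<And>k. k \<in> K \<Longrightarrow> c k = a k + b k + of_bool (k = x) + of_bool (k = y)"
proof -
  \<comment> \<open>The requirement below a child of colour \<open>z\<close>, extended to all of
    \<open>K\<close> by ignoring \<open>z\<close>.\<close>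
  define g where "g z S = (2 ^ (card (S - {z}) + 1) - 2 :: int)" for z :: 'a and S
  define c' where "c' k = c k - of_bool (k = x) - of_bool (k = y)" for k
  have c': "sum c' S = sum c S - of_bool (x \<in> S) - of_bool (y \<in> S)" if "S \<subseteq> K" for S
  proof -
    have "finite S" using that K(1) finite_subset by blast
    then show ?thesis
      by (simp add: c'_def sum_subtractf of_bool_def)
  qed
  have sup: "supermodular_on K (g z)" for z
    unfolding g_def by (rule supermodular_on_pow2_card[OF K(1)])
  have "supermodular_on K (\<lambda>S. - (sum c' S - g y S))"
    unfolding supermodular_on_def
  proof (intro allI impI)
    fix S T assume ST: "S \<subseteq> K" "T \<subseteq> K"
    then have "finite S" "finite T" using K(1) finite_subset by blast+
    then have "sum c' S + sum c' T = sum c' (S \<union> T) + sum c' (S \<inter> T)"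
      using sum.union_inter[of S T c'] by simp
    then show "- (sum c' S - g y S) + - (sum c' T - g y T)
        \<le> - (sum c' (S \<union> T) - g y (S \<union> T)) + - (sum c' (S \<inter> T) - g y (S \<inter> T))"
      using supermodular_onD[OF sup ST, of y] by linarith
  qed
  moreover have "g x S \<le> sum c' S - g y S" if "S \<subseteq> K" for S
    using dom[OF that] c'[OF that] by (simp add: g_def)
  ultimately obtain a where a: "\<And>S. S \<subseteq> K \<Longrightarrow> g x S \<le> sum a S \<and> sum a S \<le> sum c' S - g y S"
    using discrete_sandwich[OF K(1) sup, of "\<lambda>S. sum c' S - g y S" x] by (auto simp: g_def)
  define b where "b k = c' k - a k" for k
  have b: "g y S \<le> sum b S" if "S \<subseteq> K" for S
    using a[OF that] by (simp add: b_def sum_subtractf)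
  obtain n where n: "card K = Suc n"
    using K by (metis card_Suc_Diff1)
  have gK: "g z K = 2 ^ (n + 1) - 2" if "z \<in> K" for z
    using that n K(1) by (simp add: g_def)
  \<comment> \<open>Removing the two children from \<open>2^(n+2) - 2\<close> nodes leaves exactly
    twice \<open>2^(n+1) - 2\<close>, so the bounds meet at \<open>K\<close> and force both
    totals.\<close>
  have tot: "sum c' K = g x K + g y K"
    using c'[of K] c K gK n by simp
  have aK: "sum a K = g x K" and bK: "sum b K = g y K"
    using a[of K] tot by (auto simp: b_def sum_subtractf)
  have feas: "d z = 0 \<and> feasible_on (K - {z}) d"
    if z: "z \<in> K" and d: "\<And>S. S \<subseteq> K \<Longrightarrow> g z S \<le> sum d S" and dK: "sum d K = g z K"
    for z and d :: "'a \<Rightarrow> int"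
  proof -
    have "sum d K = d z + sum d (K - {z})"
      using K(1) z by (rule sum.remove)
    moreover have "g z (K - {z}) = g z K"
      by (simp add: g_def)
    \<comment> \<open>The bound at \<open>{z}\<close> makes \<open>d z\<close> nonnegative; the
      bound at \<open>K - {z}\<close> already equals the total, so \<open>d z\<close> is also
      nonpositive.\<close>
    ultimately have "d z = 0"
      using d[of "{z}"] d[of "K - {z}"] dK z by (auto simp: g_def)
    moreover have "sum d (K - {z}) = g z K"
      using \<open>d z = 0\<close> \<open>sum d K = d z + sum d (K - {z})\<close> dK by simp
    moreover have "2 ^ (card S + 1) - 2 \<le> sum d S" if "S \<subseteq> K - {z}" for S
    proof -
      have "S \<subseteq> K" "S - {z} = S" using that by auto
      then show ?thesis using d[of S] by (simp add: g_def)
    qed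
    ultimately show ?thesis
      by (auto simp: feasible_on_def g_def)
  qed
  show thesis
  proof (rule that)
    show "feasible_on (K - {x}) a" "a x = 0"
      using feas[OF K(2), of a] a aK by auto
    show "feasible_on (K - {y}) b" "b y = 0"
      using feas[OF K(3), of b] b bK by auto
    show "c k = a k + b k + of_bool (k = x) + of_bool (k = y)" for k
      by (simp add: b_def c'_def)
  qed
qed

lemma ex_min_on:
  fixes c :: "'a \<Rightarrow> int"
  assumes "finite K" "K \<noteq> {}"
  obtains x where "x \<in> K" "\<And>k. k \<in> K \<Longrightarrow> c x \<le> c k"
proof -
  have "Min (c ` K) \<in> c ` K" using assms by simp
  then obtain x where "x \<in> K" "c x = Min (c ` K)" by auto
  then show thesis using that[of x] assms by simp
qed

lemma feasible_on_split:
  fixes c :: "'a \<Rightarrow> int"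
  assumes K: "finite K" "K \<noteq> {}" and feas: "feasible_on K c"
  obtains x y a b where "x \<in> K" "y \<in> K" "feasible_on (K - {x}) a" "feasible_on (K - {y}) b"
    "a x = 0" "b y = 0" "\<And>k. k \<in> K \<Longrightarrow> c k = a k + b k + of_bool (k = x) + of_bool (k = y)"
proof -
  have lower: "2 ^ (card S + 1) - 2 \<le> sum c S" if "S \<subseteq> K" for S
    using feas that by (auto simp: feasible_on_def)
  have total: "sum c K = 2 ^ (card K + 1) - 2"
    using feas by (auto simp: feasible_on_def)
  have finS: "finite S" if "S \<subseteq> K" for S
    using that K(1) finite_subset by blast
  obtain x where x: "x \<in> K" "\<And>k. k \<in> K \<Longrightarrow> c x \<le> c k"
    using ex_min_on[OF K] by blast
  have "2 \<le> c x" using lower[of "{x}"] x by simp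
  then consider "c x = 2" | "3 \<le> c x" by linarith
  then show thesis
  proof cases
    case 1
    have "(2 ^ (card (S - {x}) + 1) - 2) + (2 ^ (card (S - {x}) + 1) - 2)
        \<le> sum c S - of_bool (x \<in> S) - of_bool (x \<in> S)" if S: "S \<subseteq> K" for S
    proof (cases "x \<in> S")
      case True
      then obtain n where "card S = Suc n"
        using finS[OF S] by (metis card_Suc_Diff1)
      then show ?thesis using lower[OF S] True finS[OF S] by simp
    next
      case False
      \<comment> \<open>Feasibility at \<open>insert x S\<close> gives
        \<open>2^(card S + 2) - 2\<close>; taking away \<open>c x = 2\<close> leaves exactly the two
        requirements at \<open>S\<close>.\<close>
      then show ?thesis using lower[of "insert x S"] x(1) S finS[OF S] 1 by simp
    qed
    from K(1) x(1) x(1) total this show thesis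
    proof (rule feasible_on_split_if_dominated)
      fix a b
      assume "feasible_on (K - {x}) a" "feasible_on (K - {x}) b" "a x = 0" "b x = 0"
        and "\<And>k. k \<in> K \<Longrightarrow> c k = a k + b k + of_bool (k = x) + of_bool (k = x)"
      with x(1) x(1) show thesis by (rule that)
    qed
  next
    case 2
    have "K - {x} \<noteq> {}"
    proof
      assume "K - {x} = {}"
      then have "K = {x}" using x(1) by auto
      then show False using total 2 by simp
    qed
    then obtain y where y: "y \<in> K" "y \<noteq> x" "\<And>k. k \<in> K - {x} \<Longrightarrow> c y \<le> c k"
      using ex_min_on[of "K - {x}" c] K(1) by blast
    have xy: "c x \<le> c y" using x y by simp
    \<comment> \<open>These are domination at \<open>T\<close> and at \<open>insert x T\<close>; the
      latter also settles \<open>insert y T\<close>, as \<open>c x <= c y\<close>.\<close>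
    have rest: "2 ^ (card T + 2) - 4 \<le> sum c T \<and> 6 * 2 ^ card T - 3 \<le> c x + sum c T"
      if T: "T \<subseteq> K - {x, y}" for T
    proof -
      have finT: "finite T" using T finS[of T] by auto
      have "(\<Sum>k\<in>T. c y) \<le> sum c T"
        by (rule sum_mono) (use T y in auto)
      then have avg: "int (card T) * c y \<le> sum c T" by simp
      have "x \<notin> T" "y \<notin> T" "insert x (insert y T) \<subseteq> K" using T x y by auto
      then have all: "8 * 2 ^ card T - 2 \<le> c x + (c y + sum c T)"
        using lower[of "insert x (insert y T)"] y(2) finT by simp
      consider "card T = 0" | "card T = 1" | "card T = 2" | "3 \<le> card T" by linarith
      then show ?thesis
      proof cases
        case 1
        then have "T = {}" using finT by simp
        \<comment> \<open>For empty \<open>T\<close> the second inequality is just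
          \<open>3 <= c x\<close>, which is why \<open>c x = 2\<close> is treated apart.\<close>
        then show ?thesis using 2 by simp
      next
        case 4
        \<comment> \<open>Now \<open>c x\<close> and \<open>c y\<close> are each at most a third of
          \<open>sum c T\<close>. By \<open>all\<close>, \<open>sum c T\<close> is at least 3/5 and
          \<open>c x + sum c T\<close> at least 3/4 of \<open>8 * 2^card T - 2\<close>, which
          suffices.\<close>
        have "3 * c y \<le> int (card T) * c y"
          using 4 2 xy by (intro mult_right_mono) auto
        then have "3 * c y \<le> sum c T" using avg by simp
        then show ?thesis using all 2 xy by auto
      qed (use avg all 2 xy in auto)
    qed
    have "(2 ^ (card (S - {x}) + 1) - 2) + (2 ^ (card (S - {y}) + 1) - 2)
        \<le> sum c S - of_bool (x \<in> S) - of_bool (y \<in> S)" if S: "S \<subseteq> K" for S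
    proof -
      define T where "T = S - {x, y}"
      have T: "T \<subseteq> K - {x, y}" "finite T" "x \<notin> T" "y \<notin> T"
        using S finS[OF S] by (auto simp: T_def)
      note r = rest[OF T(1)]
      consider "S = T" | "S = insert x T" | "S = insert y T" | "S = insert x (insert y T)"
        by (auto simp: T_def)
      then show ?thesis
      proof cases
        case 1
        then show ?thesis using r T by simp
      next
        case 2
        have "S - {x} = T" "S - {y} = S" using 2 T y by auto
        then show ?thesis using r T y(2) 2 by simp
      next
        case 3
        have "S - {y} = T" "S - {x} = S" using 3 T y by auto
        then show ?thesis using r T y(2) 3 xy by simp
      next
        case 4
        \<comment> \<open>The two requirements add up to \<open>2^(card S + 1) - 4\<close>, two less
          than feasibility gives; the difference pays for the two children.\<close>
        have "S - {x} = insert y T" "S - {y} = insert x T" using 4 T y by auto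
        then show ?thesis using lower[OF S] T y(2) 4 by simp
      qed
    qed
    from K(1) x(1) y(1) total this show thesis
    proof (rule feasible_on_split_if_dominated)
      fix a b
      assume "feasible_on (K - {x}) a" "feasible_on (K - {y}) b" "a x = 0" "b y = 0"
        and "\<And>k. k \<in> K \<Longrightarrow> c k = a k + b k + of_bool (k = x) + of_bool (k = y)"
      with x(1) y(1) show thesis by (rule that)
    qed
  qed
qed

section \<open>Descendants by repeated halving, and colourings by recursion on the height\<close>

section \<open>Colourings of perfect binary trees\<close>

text \<open>The parent of \<open>v\<close> is \<open>v div 2\<close>, so relative depth becomes an
  exponent; \<open>0 < d\<close> leaves out \<open>R\<close> itself. A general \<open>R\<close> lets
  inductions move to the children.\<close>

definition below :: "nat \<Rightarrow> nat \<Rightarrow> nat set" where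
  "below h R = {v. \<exists>d. 0 < d \<and> d \<le> h \<and> v div 2 ^ d = R}"

lemma div_pow2_add: "v div 2 ^ (d + e) = v div 2 ^ d div 2 ^ e" for v :: nat
  by (simp add: power_add div_mult2_eq)

lemma below_0 [simp]: "below 0 R = {}"
  by (auto simp: below_def)

lemma below_Suc: "below (Suc h) R = (\<Union>S\<in>{2 * R, 2 * R + 1}. insert S (below h S))"
proof -
  have "v \<in> below (Suc h) R \<longleftrightarrow> (\<exists>S\<in>{2 * R, 2 * R + 1}. \<exists>d\<le>h. v div 2 ^ d = S)" for v
  proof -
    have "v \<in> below (Suc h) R \<longleftrightarrow> (\<exists>d\<le>h. v div 2 ^ Suc d = R)"
      unfolding below_def by (auto simp: Suc_le_eq gr0_conv_Suc)
    also have "\<dots> \<longleftrightarrow> (\<exists>d\<le>h. v div 2 ^ d \<in> {2 * R, 2 * R + 1})"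
    proof -
      have half: "n div 2 = R \<longleftrightarrow> n = 2 * R \<or> n = 2 * R + 1" for n :: nat
        by presburger
      have "v div 2 ^ Suc d = R \<longleftrightarrow> v div 2 ^ d \<in> {2 * R, 2 * R + 1}" for d
        using div_pow2_add[of v d 1] half by simp
      then show ?thesis by simp
    qed
    finally show ?thesis by auto
  qed
  moreover have "v \<in> insert S (below h S) \<longleftrightarrow> (\<exists>d\<le>h. v div 2 ^ d = S)" for v S
    unfolding below_def by (auto intro: exI[of _ 0]) (metis div_by_1 neq0_conv power_0)
  ultimately show ?thesis by blast
qed

lemma finite_below [simp]: "finite (below h R)"
  by (induction h arbitrary: R) (auto simp: below_Suc)

lemma below_1: "below h 1 = tree_nodes h - {1}"
proof -
  have "v \<in> below h 1 \<longleftrightarrow> 2 \<le> v \<and> v < 2 ^ Suc h" for v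
  proof
    assume "v \<in> below h 1"
    then obtain d where d: "0 < d" "d \<le> h" "v div 2 ^ d = 1"
      by (auto simp: below_def)
    have "v = 2 ^ d + v mod 2 ^ d"
      using div_mult_mod_eq[of v "2 ^ d"] d(3) by simp
    moreover have "v mod 2 ^ d < 2 ^ d"
      by simp
    ultimately have "v < 2 ^ Suc d" "2 ^ d \<le> v"
      unfolding power_Suc by linarith+
    moreover have "(2::nat) ^ Suc d \<le> 2 ^ Suc h" "(2::nat) ^ 1 \<le> 2 ^ d"
      using d by (intro power_increasing; simp)+
    ultimately show "2 \<le> v \<and> v < 2 ^ Suc h" unfolding power_one_right by linarith
  next
    assume v: "2 \<le> v \<and> v < 2 ^ Suc h"
    then show "v \<in> below h 1"
    proof (induction h)
      case (Suc h)
      show ?case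
      proof (cases "v < 2 ^ Suc h")
        case True
        then show ?thesis using Suc by (force simp: below_def)
      next
        case False
        then have "v div 2 ^ Suc h = 1"
          using Suc.prems by (intro div_nat_eqI) auto
        then show ?thesis by (auto simp: below_def intro!: exI[of _ "Suc h"])
      qed
    qed auto
  qed
  moreover have "v \<in> tree_nodes h - {1} \<longleftrightarrow> 2 \<le> v \<and> v < 2 ^ Suc h" for v
    unfolding tree_nodes_def Suc_eq_plus1 Diff_iff atLeastAtMost_iff singleton_iff by linarith
  ultimately show ?thesis
    by blast
qed

text \<open>An edge is one halving, so a path with \<open>d\<close> edges divides by
  \<open>2 ^ d\<close>. The bound on \<open>v\<close> makes every halved node internal, and
  \<open>1 <= u\<close> stops the halving at the root.\<close>

lemma ancestor_iff:
  assumes "1 \<le> u" "v < 2 ^ (h + 1)"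
  shows "ancestor h u v \<longleftrightarrow> (\<exists>d>0. v div 2 ^ d = u)"
proof
  assume "ancestor h u v"
  then have "(u, v) \<in> (tree_edges h)\<^sup>+" by (simp add: ancestor_def)
  then show "\<exists>d>0. v div 2 ^ d = u"
  proof (induction rule: trancl_induct)
    case (base w)
    then have "w div 2 ^ 1 = u" by (auto simp: tree_edges_def)
    then show ?case by (intro exI[of _ 1]) simp
  next
    case (step w z)
    then obtain d where d: "d > 0" "w div 2 ^ d = u" by blast
    have "z div 2 ^ 1 = w" using step.hyps by (auto simp: tree_edges_def)
    then have "z div 2 ^ (1 + d) = u" using div_pow2_add[of z 1 d] d by simp
    then show ?case by (intro exI[of _ "1 + d"]) simp
  qed
next
  assume "\<exists>d>0. v div 2 ^ d = u"
  then obtain d where d: "v div 2 ^ Suc d = u" by (auto simp: gr0_conv_Suc)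
  have edge: "(w div 2, w) \<in> tree_edges h" if "1 \<le> w div 2" "w < 2 ^ (h + 1)" for w
    using that by (auto simp: tree_edges_def)
  have "(u, v) \<in> (tree_edges h)\<^sup>+"
    using d assms(1)
  proof (induction d arbitrary: u)
    case 0
    then show ?case using edge[of v] assms(2) by auto
  next
    case (Suc d)
    define w where "w = v div 2 ^ Suc d"
    have w: "w div 2 = u" using Suc.prems(1) div_pow2_add[of v "Suc d" 1] by (simp add: w_def)
    then have "1 \<le> w" using Suc.prems(2) by auto
    have "w \<le> v" unfolding w_def by (rule div_le_dividend)
    then have "(u, w) \<in> tree_edges h" using edge[of w] w Suc.prems(2) assms(2) by auto
    moreover have "(w, v) \<in> (tree_edges h)\<^sup>+"
      using Suc.IH[of w] \<open>1 \<le> w\<close> by (simp add: w_def)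
    ultimately show ?case by simp
  qed
  then show "ancestor h u v" by (simp add: ancestor_def)
qed

text \<open>Halving a child of \<open>R\<close> gives \<open>R\<close>, and further halving never
  increases it, so for positive \<open>R\<close> neither child is met again.\<close>

lemma child_depth_unique:
  fixes v :: nat
  assumes "1 \<le> R" "v div 2 ^ d = S" "v div 2 ^ e = S'"
    and "S \<in> {2 * R, 2 * R + 1}" "S' \<in> {2 * R, 2 * R + 1}"
  shows "d = e"
proof -
  have aux: False if "d < e" "v div 2 ^ d \<in> {2 * R, 2 * R + 1}" "v div 2 ^ e \<in> {2 * R, 2 * R + 1}"
    for d e :: nat
  proof -
    obtain k where k: "e = d + (1 + k)" using less_imp_Suc_add[OF \<open>d < e\<close>] by auto
    have "v div 2 ^ e = v div 2 ^ d div 2 div 2 ^ k"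
      unfolding k div_pow2_add by simp
    also have "\<dots> \<le> v div 2 ^ d div 2" by (rule div_le_dividend)
    also have "\<dots> = R" using that(2) by auto
    finally show False using that(3) assms(1) by auto
  qed
  show ?thesis
    using aux[of d e] aux[of e d] assms by (meson linorder_neqE_nat)
qed

lemma below_children_disjoint:
  assumes "1 \<le> R"
  shows "insert (2 * R) (below h (2 * R)) \<inter> insert (2 * R + 1) (below h (2 * R + 1)) = {}"
proof -
  have ex: "\<exists>d. v div 2 ^ d = S" if "v \<in> insert S (below h S)" for v S :: nat
    using that by (auto simp: below_def intro: exI[of _ 0])
  have False if v: "v \<in> insert (2 * R) (below h (2 * R))" "v \<in> insert (2 * R + 1) (below h (2 * R + 1))"
    for v
  proof -
    obtain d e where de: "v div 2 ^ d = 2 * R" "v div 2 ^ e = 2 * R + 1"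
      using ex[OF v(1)] ex[OF v(2)] by blast
    then have "d = e" by (rule child_depth_unique[OF assms]) auto
    then show False using de by simp
  qed
  then show ?thesis by blast
qed

lemma notin_below:
  assumes "1 \<le> S" shows "S \<notin> below h S"
proof
  assume "S \<in> below h S"
  then obtain d where d: "0 < d" "S div 2 ^ d = S" by (auto simp: below_def)
  have "S div 2 ^ d < S" using assms d(1) by (intro div_less_dividend one_less_power) auto
  then show False using d by simp
qed

text \<open>Deleting the colour of a child from the palette of its subtree replaces the comparison
  of ancestor pairs. \<open>R\<close> itself is unconstrained, like the colourless root.\<close>

fun proper :: "nat \<Rightarrow> nat \<Rightarrow> 'a set \<Rightarrow> (nat \<Rightarrow> 'a) \<Rightarrow> bool" where
  "proper 0 R K f \<longleftrightarrow> True"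
| "proper (Suc h) R K f \<longleftrightarrow> (\<forall>S\<in>{2 * R, 2 * R + 1}. f S \<in> K \<and> proper h S (K - {f S}) f)"

text \<open>In an ancestor pair below \<open>R\<close>, the upper node either is a child of
  \<open>R\<close>, where the reduced palette separates the colours, or lies strictly below the same
  child as the lower node, where the induction hypothesis applies.\<close>

lemma proper_iff:
  assumes "1 \<le> R"
  shows "proper h R K f \<longleftrightarrow> (\<forall>v\<in>below h R. f v \<in> K) \<and>
    (\<forall>u\<in>below h R. \<forall>v\<in>below h R. (\<exists>d>0. v div 2 ^ d = u) \<longrightarrow> f u \<noteq> f v)"
  using assms
proof (induction h arbitrary: R K)
  case 0
  then show ?case by simp
next
  case (Suc h)
  let ?C = "{2 * R, 2 * R + 1}"
  have pos: "1 \<le> S" if "S \<in> ?C" for S using that Suc.prems by auto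
  have inv: "\<exists>S\<in>?C. v \<in> below h S \<and> u \<in> insert S (below h S)"
    if uv: "u \<in> below (Suc h) R" "v \<in> below (Suc h) R" "d > 0" "v div 2 ^ d = u" for u v d
  proof -
    obtain S where S: "S \<in> ?C" "u \<in> insert S (below h S)" using uv(1) by (auto simp: below_Suc)
    obtain S' where S': "S' \<in> ?C" "v \<in> insert S' (below h S')" using uv(2) by (auto simp: below_Suc)
    obtain i where i: "u div 2 ^ i = S"
      using S(2) by (auto simp: below_def intro: that[of 0])
    obtain j where j: "v div 2 ^ j = S'" "j = 0 \<longrightarrow> v = S'" "j \<noteq> 0 \<longrightarrow> v \<in> below h S'"
      using S'(2) by (auto simp: below_def intro: that[of 0])
    have "v div 2 ^ (d + i) = S" using div_pow2_add[of v d i] uv(4) i by simp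
    \<comment> \<open>Both exponents lead from \<open>v\<close> to a child of \<open>R\<close>, so
      they agree; hence \<open>u\<close> and \<open>v\<close> share that child, and \<open>j\<close>
      is positive because \<open>d\<close> is.\<close>
    then have "d + i = j"
      using child_depth_unique[OF Suc.prems _ j(1) S(1) S'(1)] by blast
    then have "S = S'"
      using \<open>v div 2 ^ (d + i) = S\<close> j(1) by simp
    then show ?thesis using S uv(3) j(3) \<open>d + i = j\<close> by auto
  qed
  have anc: "\<exists>d>0. v div 2 ^ d = S" if "v \<in> below h S" for v S
    using that by (auto simp: below_def)
  have IH: "proper h S (K - {f S}) f \<longleftrightarrow> (\<forall>v\<in>below h S. f v \<in> K - {f S}) \<and>
      (\<forall>u\<in>below h S. \<forall>v\<in>below h S. (\<exists>d>0. v div 2 ^ d = u) \<longrightarrow> f u \<noteq> f v)" if "S \<in> ?C" for S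
    using Suc.IH[OF pos[OF that]] .
  show ?case (is "?l \<longleftrightarrow> ?r")
  proof
    assume ?l
    then have l: "f S \<in> K" "proper h S (K - {f S}) f" if "S \<in> ?C" for S
      using that by (simp, blast)+
    have lK: "f v \<in> K - {f S}" if "S \<in> ?C" "v \<in> below h S" for S v
      using l(2)[OF that(1)] that(2) unfolding IH[OF that(1)] by blast
    have lC: "f u \<noteq> f v"
      if "S \<in> ?C" "u \<in> below h S" "v \<in> below h S" "\<exists>d>0. v div 2 ^ d = u" for S u v
      using l(2)[OF that(1)] that(2-4) unfolding IH[OF that(1)] by blast
    have "f v \<in> K" if "v \<in> below (Suc h) R" for v
      using that l(1) lK unfolding below_Suc by blast
    moreover have "f u \<noteq> f v" if uv: "u \<in> below (Suc h) R" "v \<in> below (Suc h) R" "d > 0" "v div 2 ^ d = u"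
      for u v d
    proof -
      obtain S where S: "S \<in> ?C" "v \<in> below h S" "u \<in> insert S (below h S)"
        using inv[OF uv] by blast
      show ?thesis
      proof (cases "u = S")
        case True
        then show ?thesis using lK[OF S(1,2)] by auto
      next
        case False
        then show ?thesis using lC[OF S(1) _ S(2), of u] S(3) uv(3,4) by blast
      qed
    qed
    ultimately show ?r by blast
  next
    assume r: ?r
    have sub: "insert S (below h S) \<subseteq> below (Suc h) R" if "S \<in> ?C" for S
      using that unfolding below_Suc by blast
    have "f S \<in> K \<and> proper h S (K - {f S}) f" if S: "S \<in> ?C" for S
    proof -
      have rK: "f v \<in> K" if "v \<in> insert S (below h S)" for v
        using r sub[OF S] that by blast
      have rC: "f u \<noteq> f v"
        if "u \<in> insert S (below h S)" "v \<in> insert S (below h S)" "\<exists>d>0. v div 2 ^ d = u" for u v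
        using r[THEN conjunct2, THEN bspec, THEN bspec, THEN mp] subsetD[OF sub[OF S]] that by metis
      have "f v \<in> K - {f S}" if "v \<in> below h S" for v
        using rK[of v] rC[of S v] anc[OF that] that by auto
      then have "proper h S (K - {f S}) f"
        unfolding IH[OF S] using rC[OF insertI2 insertI2] by (intro conjI ballI impI)
      then show ?thesis using rK by simp
    qed
    then show ?l by simp
  qed
qed

lemma proper_in_palette:
  assumes "1 \<le> R" "proper h R K f" "v \<in> below h R"
  shows "f v \<in> K"
  using assms(2)[unfolded proper_iff[OF assms(1)], THEN conjunct1] assms(3) by (rule bspec)

lemma proper_cong:
  assumes "\<And>v. v \<in> below h R \<Longrightarrow> f v = g v"
  shows "proper h R K f \<longleftrightarrow> proper h R K g"
  using assms
proof (induction h arbitrary: R K)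
  case (Suc h)
  have "f S = g S \<and> proper h S L f = proper h S L g" if "S \<in> {2 * R, 2 * R + 1}" for S L
    using Suc.prems Suc.IH[of S L] that unfolding below_Suc by blast
  then show ?case by simp
qed simp

lemma ancestral_coloring_iff:
  "ancestral_coloring h c f \<longleftrightarrow>
     proper h 1 {1..h} f \<and> (\<forall>i\<in>{1..h}. card {v \<in> below h 1. f v = i} = c i)"
proof -
  have "ancestor h u v \<longleftrightarrow> (\<exists>d>0. v div 2 ^ d = u)" if "u \<in> below h 1" "v \<in> below h 1" for u v
    using that unfolding below_1 by (intro ancestor_iff) (auto simp: tree_nodes_def)
  then show ?thesis
    unfolding ancestral_coloring_def below_1[symmetric] proper_iff[OF order_refl] by blast
qed

section \<open>Colour counts along the recursion: a lower bound and a construction\<close>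

lemma card_below_Suc_Collect:
  assumes "1 \<le> R"
  shows "card {v \<in> below (Suc h) R. P v} =
    (\<Sum>S\<in>{2 * R, 2 * R + 1}. of_bool (P S) + card {v \<in> below h S. P v})"
proof -
  let ?A = "\<lambda>S. {v \<in> insert S (below h S). P v}"
  have "{v \<in> below (Suc h) R. P v} = ?A (2 * R) \<union> ?A (2 * R + 1)"
    unfolding below_Suc by blast
  moreover have "?A (2 * R) \<inter> ?A (2 * R + 1) = {}"
    using below_children_disjoint[OF assms, of h] by blast
  ultimately have "card {v \<in> below (Suc h) R. P v} = card (?A (2 * R)) + card (?A (2 * R + 1))"
    by (simp add: card_Un_disjoint)
  moreover have "card (?A S) = of_bool (P S) + card {v \<in> below h S. P v}" if "1 \<le> S" for S
  proof -
    have "?A S = (if P S then insert S {v \<in> below h S. P v} else {v \<in> below h S. P v})"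
      by auto
    then show ?thesis using notin_below[OF that, of h] by simp
  qed
  ultimately show ?thesis using assms by simp
qed

lemma card_below:
  assumes "1 \<le> R"
  shows "card (below h R) + 2 = 2 ^ (h + 1)"
  using assms
proof (induction h arbitrary: R)
  case (Suc h)
  show ?case
    using card_below_Suc_Collect[OF Suc.prems, of h "\<lambda>_. True"] Suc.IH[of "2 * R"]
      Suc.IH[of "2 * R + 1"] Suc.prems by simp
qed simp

text \<open>Each child with its subtree contributes at least \<open>2^card T - 1\<close>: if its
  colour is in \<open>T\<close>, it counts itself and the nodes below add
  \<open>2^card T - 2\<close>; otherwise those below alone give \<open>2^(card T + 1) - 2\<close>.
  At height 0 the palette, and so \<open>T\<close>, is empty.\<close>

lemma proper_card_ge:
  assumes "1 \<le> R" "finite K" "card K = h" "proper h R K f" "T \<subseteq> K"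
  shows "2 ^ (card T + 1) \<le> card {v \<in> below h R. f v \<in> T} + 2"
  using assms
proof (induction h arbitrary: R K T)
  case 0
  then show ?case by simp
next
  case (Suc h)
  have child: "2 ^ card T \<le> of_bool (f S \<in> T) + card {v \<in> below h S. f v \<in> T} + 1"
    if S: "S \<in> {2 * R, 2 * R + 1}" for S
  proof -
    have fS: "f S \<in> K" "proper h S (K - {f S}) f" using Suc.prems(4) S by auto
    have "1 \<le> S" using S Suc.prems(1) by auto
    have "finite T" using Suc.prems finite_subset by blast
    have fib: "{v \<in> below h S. f v \<in> T - {f S}} = {v \<in> below h S. f v \<in> T}"
      using proper_in_palette[OF \<open>1 \<le> S\<close> fS(2)] by auto
    have "2 ^ (card (T - {f S}) + 1) \<le> card {v \<in> below h S. f v \<in> T - {f S}} + 2"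
      by (rule Suc.IH[OF \<open>1 \<le> S\<close> _ _ fS(2)]) (use Suc.prems fS in auto)
    note IH = this[unfolded fib]
    show ?thesis
    proof (cases "f S \<in> T")
      case True
      then obtain n where "card T = Suc n"
        using \<open>finite T\<close> by (metis card_Suc_Diff1)
      then show ?thesis using IH True \<open>finite T\<close> by simp
    next
      case False
      have "(1::nat) \<le> 2 ^ card T" by simp
      then show ?thesis using IH False by simp
    qed
  qed
  show ?case
    using child[of "2 * R"] child[of "2 * R + 1"]
    unfolding card_below_Suc_Collect[OF Suc.prems(1)] by simp
qed

lemma feasible_on_ex_proper:
  assumes "1 \<le> R" "finite K" "card K = h" "feasible_on K c"
  shows "\<exists>f. proper h R K f \<and> (\<forall>k\<in>K. int (card {v \<in> below h R. f v = k}) = c k)"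
  using assms
proof (induction h arbitrary: R K c)
  case 0
  then show ?case by simp
next
  case (Suc h)
  have "K \<noteq> {}" using Suc.prems by auto
  then obtain x y a b where xy: "x \<in> K" "y \<in> K"
    and ab: "feasible_on (K - {x}) a" "feasible_on (K - {y}) b" "a x = 0" "b y = 0"
    and c: "\<And>k. k \<in> K \<Longrightarrow> c k = a k + b k + of_bool (k = x) + of_bool (k = y)"
    using feasible_on_split[OF Suc.prems(2) _ Suc.prems(4)] by metis
  let ?L = "2 * R" and ?R = "2 * R + 1"
  have pos: "1 \<le> ?L" "1 \<le> ?R" using Suc.prems by auto
  obtain f1 where f1: "proper h ?L (K - {x}) f1"
    "\<And>k. k \<in> K - {x} \<Longrightarrow> int (card {v \<in> below h ?L. f1 v = k}) = a k"
    using Suc.IH[OF pos(1) _ _ ab(1)] Suc.prems xy by auto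
  obtain f2 where f2: "proper h ?R (K - {y}) f2"
    "\<And>k. k \<in> K - {y} \<Longrightarrow> int (card {v \<in> below h ?R. f2 v = k}) = b k"
    using Suc.IH[OF pos(2) _ _ ab(2)] Suc.prems xy by auto
  \<comment> \<open>The induction hypothesis speaks only of the palette without \<open>x\<close>;
    the colour \<open>x\<close> is absent below this child, in accordance with
    \<open>a x = 0\<close>.\<close>
  have a: "int (card {v \<in> below h ?L. f1 v = k}) = a k" if "k \<in> K" for k
  proof (cases "k = x")
    case True
    then have "{v \<in> below h ?L. f1 v = k} = {}"
      using proper_in_palette[OF pos(1) f1(1)] by auto
    then show ?thesis using ab True by simp
  qed (use f1 that in auto)
  have b: "int (card {v \<in> below h ?R. f2 v = k}) = b k" if "k \<in> K" for k
  proof (cases "k = y")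
    case True
    then have "{v \<in> below h ?R. f2 v = k} = {}"
      using proper_in_palette[OF pos(2) f2(1)] by auto
    then show ?thesis using ab True by simp
  qed (use f2 that in auto)
  \<comment> \<open>The last branch serves the right subtree; its value at any other node,
    \<open>R\<close> included, is immaterial.\<close>
  define f where "f v = (if v = ?L then x else if v = ?R then y else
      if v \<in> below h ?L then f1 v else f2 v)" for v
  have disj: "insert ?L (below h ?L) \<inter> insert ?R (below h ?R) = {}"
    by (rule below_children_disjoint[OF Suc.prems(1)])
  have eqL: "f v = f1 v" if "v \<in> below h ?L" for v
    using that disj notin_below[OF pos(1)] unfolding f_def by (metis disjoint_iff insert_iff)
  have eqR: "f v = f2 v" if "v \<in> below h ?R" for v
    using that disj notin_below[OF pos(2)] unfolding f_def by (metis disjoint_iff insert_iff)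
  have ends: "f ?L = x" "f ?R = y" by (simp_all add: f_def)
  have "proper h ?L (K - {x}) f" "proper h ?R (K - {y}) f"
    using f1(1) f2(1) proper_cong[of h ?L f f1] proper_cong[of h ?R f f2] eqL eqR by auto
  then have "proper (Suc h) R K f"
    using ends xy by simp
  moreover have "int (card {v \<in> below (Suc h) R. f v = k}) = c k" if "k \<in> K" for k
  proof -
    have "{v \<in> below h ?L. f v = k} = {v \<in> below h ?L. f1 v = k}"
      "{v \<in> below h ?R. f v = k} = {v \<in> below h ?R. f2 v = k}"
      using eqL eqR by auto
    then have "int (card {v \<in> below (Suc h) R. f v = k}) =
        of_bool (x = k) + a k + (of_bool (y = k) + b k)"
      unfolding card_below_Suc_Collect[OF Suc.prems(1)] using ends a[OF that] b[OF that] by simp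
    then show ?thesis using c[OF that] by (simp add: eq_commute)
  qed
  ultimately show ?case by blast
qed

section \<open>Ordered sequences against sets of colours, and the equivalence\<close>

section \<open>Feasible sequences\<close>

lemma sum_pow2: "(\<Sum>i=1..l. 2 ^ i) + 2 = (2 ^ (l + 1) :: nat)"
  by (induction l) auto

text \<open>Peel off the largest index \<open>m\<close> of \<open>S\<close>: since \<open>S\<close>
  fits into \<open>{1..m}\<close>, \<open>card S <= m\<close>, and monotonicity bounds the last term
  on the left by \<open>c m\<close>. This carries (C1) over from initial segments to all sets of
  colours.\<close>

lemma sum_initial_le:
  fixes c :: "nat \<Rightarrow> nat"
  assumes "mono_on {1..h} c" "S \<subseteq> {1..h}"
  shows "(\<Sum>i=1..card S. c i) \<le> sum c S"
  using assms(2)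
proof (induction "card S" arbitrary: S)
  case 0
  then show ?case by simp
next
  case (Suc n)
  have fin: "finite S" using Suc.prems finite_subset by blast
  have "S \<noteq> {}" using Suc.hyps by auto
  define m where "m = Max S"
  have m: "m \<in> S" "S \<subseteq> {1..m}"
    using fin \<open>S \<noteq> {}\<close> Suc.prems by (auto simp: m_def)
  have "card S \<le> m" using card_mono[OF _ m(2)] by simp
  then have "c (card S) \<le> c m"
    using assms(1) m(1) Suc.prems Suc.hyps(2) by (intro mono_onD[of "{1..h}" c]) auto
  moreover have n: "n = card (S - {m})" using m fin Suc.hyps by simp
  moreover have "(\<Sum>i=1..card (S - {m}). c i) \<le> sum c (S - {m})"
    using Suc.hyps(1)[OF n] Suc.prems by blast
  ultimately show ?case
    using sum.remove[OF fin m(1), of c] Suc.hyps(2) by (simp flip: Suc.hyps(2))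
qed

lemma feasible_imp_feasible_on:
  assumes "mono_on {1..h} c" "feasible h c"
  shows "feasible_on {1..h} (\<lambda>i. int (c i))"
  unfolding feasible_on_def
proof (intro conjI allI impI)
  fix S assume S: "S \<subseteq> {1..h}"
  have "card S \<le> h" using card_mono[OF _ S] by simp
  have "(\<Sum>i=1..card S. 2 ^ i) \<le> (\<Sum>i=1..card S. c i)"
  \<comment> \<open>(C1) starts at length 1, so the empty set is treated separately.\<close>
  proof (cases "card S = 0")
    case False
    then show ?thesis using assms(2) \<open>card S \<le> h\<close> by (simp add: feasible_def)
  qed simp
  then have "2 ^ (card S + 1) \<le> sum c S + 2"
    using sum_initial_le[OF assms(1) S] sum_pow2[of "card S"] by linarith
  then have "int (2 ^ (card S + 1)) \<le> int (sum c S + 2)"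
    by (rule zle_int[THEN iffD2])
  then show "2 ^ (card S + 1) - 2 \<le> (\<Sum>i\<in>S. int (c i))"
    by simp
next
  have "sum c {1..h} + 2 = 2 ^ (h + 1)"
    using assms(2) sum_pow2[of h] by (simp add: feasible_def)
  then have "int (sum c {1..h} + 2) = int (2 ^ (h + 1))"
    by (rule arg_cong)
  then show "(\<Sum>i=1..h. int (c i)) = 2 ^ (card {1..h} + 1) - 2"
    by simp
qed

text \<open>(C1) is the counting bound for the colours \<open>{1..l}\<close>. For (C2), every node
  below the root has a colour in \<open>{1..h}\<close>, so the counts add up to the number of these
  nodes.\<close>

lemma ancestral_coloring_imp_feasible:
  assumes "ancestral_coloring h c f"
  shows "feasible h c"
proof -
  have f: "proper h 1 {1..h} f" and cnt: "\<And>i. i \<in> {1..h} \<Longrightarrow> card {v \<in> below h 1. f v = i} = c i"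
    using assms unfolding ancestral_coloring_iff by auto
  have fib: "card {v \<in> below h 1. f v \<in> {1..l}} = (\<Sum>i=1..l. c i)" if "l \<le> h" for l
  proof -
    have "{v \<in> below h 1. f v \<in> {1..l}} = (\<Union>i\<in>{1..l}. {v \<in> below h 1. f v = i})"
      by auto
    then have "card {v \<in> below h 1. f v \<in> {1..l}} = (\<Sum>i=1..l. card {v \<in> below h 1. f v = i})"
      by (simp add: card_UN_disjoint disjoint_iff del: One_nat_def)
    also have "\<dots> = (\<Sum>i=1..l. c i)"
      using cnt that by (intro sum.cong) auto
    finally show ?thesis .
  qed
  have "(\<Sum>i=1..l. 2 ^ i) \<le> (\<Sum>i=1..l. c i)" if "l \<in> {1..h}" for l
    using proper_card_ge[OF order_refl _ _ f, of "{1..l}"] fib[of l] sum_pow2[of l] that by simp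
  moreover have "(\<Sum>i=1..h. c i) = (\<Sum>i=1..h. 2 ^ i)"
  proof -
    have "{v \<in> below h 1. f v \<in> {1..h}} = below h 1"
      using proper_in_palette[OF order_refl f] by blast
    then show ?thesis using fib[of h] card_below[of 1 h] sum_pow2[of h] by simp
  qed
  ultimately show ?thesis
    using sum_pow2[of h] by (simp add: feasible_def)
qed

theorem theorem2:
  fixes h :: nat and c :: "nat \<Rightarrow> nat"
  assumes "h \<ge> 1" and "color_sequence h c"
  shows "(\<exists>f. ancestral_coloring h c f) \<longleftrightarrow> feasible h c"
proof
  assume "\<exists>f. ancestral_coloring h c f"
  then show "feasible h c" using ancestral_coloring_imp_feasible by blast
next
  assume "feasible h c"
  then have "feasible_on {1..h} (\<lambda>i. int (c i))"
    using assms(2) by (intro feasible_imp_feasible_on) (auto simp: color_sequence_def)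
  from feasible_on_ex_proper[OF order_refl _ _ this]
  show "\<exists>f. ancestral_coloring h c f"
    by (auto simp: ancestral_coloring_iff)
qed

end
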